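(* Let $s>625$ be an integer and let $\mathcal{F}$ be a $3$-uniform $[0,s]$-almost intersecting hypergraph such that for every edge $e\in\mathcal{F}$ and every pair of vertices $x,y\in e$ there is an edge of $\mathcal{F}$ disjoint from $\{x,y\}$. Then $\mathcal{F}$ has at most $6s+10$ edges. The only hypergraphs achieving this bound are obtained from a hypergraph of the form $\mathcal{M}_f$ by adding (up to four) edges contained entirely in the $4$-element set $A$, where $A,B$ are disjoint sets with $|A|=4$, $|B|\ge s+1$, $f:\binom{A}{2}\to\binom{B}{s+1}$ satisfies $f(S)=f(A\setminus S)$ for all $S\in\binom{A}{2}$, and $\mathcal{M}_f=\{S\cup\{x\}: S\in\binom{A}{2},\ x\in f(S)\}$.
   Context: A $3$-uniform hypergraph is a finite set of distinct $3$-element sets. It is $[0,s]$-almost intersecting if every edge is disjoint from at most $s$ edges of the hypergraph. $\binom{S}{j}$ denotes the family of $j$-element subsets of $S$. *)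

theory Defs
  imports "HOL-Library.Ramsey"
begin

text \<open>A hypergraph is represented by its set of edges. The family of \<open>j\<close>-element subsets
  of \<open>S\<close> is \<^const>\<open>nsets\<close> \<open>S j\<close> from the library.\<close>

definition uniform_hypergraph :: "nat \<Rightarrow> 'a set set \<Rightarrow> bool" where
  "uniform_hypergraph k F \<longleftrightarrow> finite F \<and> (\<forall>e\<in>F. finite e \<and> card e = k)"

definition almost_intersecting :: "nat \<Rightarrow> 'a set set \<Rightarrow> bool" where
  "almost_intersecting s F \<longleftrightarrow> (\<forall>e\<in>F. card {e'\<in>F. disjnt e e'} \<le> s)"

definition pairs_avoided :: "'a set set \<Rightarrow> bool" where
  "pairs_avoided F \<longleftrightarrow>
     (\<forall>e\<in>F. \<forall>x\<in>e. \<forall>y\<in>e. x \<noteq> y \<longrightarrow> (\<exists>e'\<in>F. disjnt e' {x, y}))"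

definition M_datum :: "nat \<Rightarrow> 'a set \<Rightarrow> 'a set \<Rightarrow> ('a set \<Rightarrow> 'a set) \<Rightarrow> bool" where
  "M_datum s A B f \<longleftrightarrow>
     finite A \<and> card A = 4 \<and> finite B \<and> card B \<ge> s + 1 \<and> disjnt A B \<and>
     f \<in> nsets A 2 \<rightarrow> nsets B (s + 1) \<and>
     (\<forall>S\<in>nsets A 2. f S = f (A - S))"

text \<open>Only the values of \<open>f\<close> on two-element subsets of \<open>A\<close> matter.\<close>

definition M_hypergraph :: "'a set \<Rightarrow> ('a set \<Rightarrow> 'a set) \<Rightarrow> 'a set set" where
  "M_hypergraph A f = {S \<union> {x} | S x. S \<in> nsets A 2 \<and> x \<in> f S}"

end

theory Submission
  imports Defs
begin

text \<open>
  Let \<open>F\<close> have at least \<open>6 s + 10\<close> edges. If \<open>G\<close> is a subfamily of \<open>N\<close> edges such that every edge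
  of \<open>R \<subseteq> F\<close> meets at most \<open>c\<close> members of \<open>G\<close>, then double counting the disjoint pairs in
  \<open>G \<times> R\<close> gives \<open>(N - c) |R| \<le> s N\<close>; when \<open>N\<close> is large compared with \<open>c\<close>, the set \<open>R\<close> has hardly
  more than \<open>s\<close> elements. Call a pair of vertices heavy if it lies in at least 57 edges. Applied to
  the edges through a heavy pair, with \<open>c = 3\<close>, the estimate shows that all but about \<open>s\<close> edges meet
  that pair; applied to edges without heavy pairs, it bounds their number by a constant below
  \<open>2 s + 1\<close>, so that every vertex is avoided by some heavy pair. Degree estimates then show
  that any two vertices lying in heavy pairs form a heavy pair, and that two heavy pairs sharing a
  vertex have codegrees adding up to more than \<open>5 s / 4\<close>. Counting yields four such vertices; an
  edge containing at most one of these four would be disjoint from too many edges, so every edge has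
  at least two vertices in this set \<open>A\<close>. For \<open>S\<close> a pair in \<open>A\<close>, an edge \<open>(A - S) \<union> {x}\<close> is disjoint
  from all \<open>S \<union> {y}\<close> with \<open>y \<noteq> x\<close>, whence at most \<open>s + 1\<close> edges meet \<open>A\<close> in exactly \<open>S\<close>, with equality
  only for equal sets of third vertices on \<open>S\<close> and \<open>A - S\<close>.
\<close>

section \<open>Counting disjoint pairs of edges, and the size of \<open>M_hypergraph\<close>\<close>

lemma card_mult_le_of_disjnt_le:
  fixes R G :: "'a set set"
  assumes "finite G" "finite R"
    and meet: "\<And>g. g \<in> R \<Longrightarrow> card {e\<in>G. \<not> disjnt e g} \<le> c"
    and disj: "\<And>e. e \<in> G \<Longrightarrow> card {g\<in>R. disjnt e g} \<le> s"
  shows "card G * card R \<le> c * card R + s * card G"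
proof -
  have "card G = card {e\<in>G. \<not> disjnt e g} + card {e\<in>G. disjnt e g}" for g
  proof -
    have "G = {e\<in>G. \<not> disjnt e g} \<union> {e\<in>G. disjnt e g}" by blast
    then show ?thesis
      using card_Un_disjoint[of "{e\<in>G. \<not> disjnt e g}" "{e\<in>G. disjnt e g}"] \<open>finite G\<close>
      by (metis (mono_tags, lifting) disjoint_iff finite_Un mem_Collect_eq)
  qed
  then have "card G * card R = (\<Sum>g\<in>R. card {e\<in>G. \<not> disjnt e g} + card {e\<in>G. disjnt e g})"
    by (simp add: mult.commute)
  also have "\<dots> = (\<Sum>g\<in>R. card {e\<in>G. \<not> disjnt e g}) + (\<Sum>g\<in>R. card {e\<in>G. disjnt e g})"
    by (rule sum.distrib)
  \<comment> \<open>Exchanging the sums counts the disjoint pairs from the side of \<open>G\<close>,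
    where \<open>disj\<close> applies.\<close>
  also have "(\<Sum>g\<in>R. card {e\<in>G. disjnt e g}) = (\<Sum>e\<in>G. card {g\<in>R. disjnt e g})"
    using sum.swap_restrict[OF \<open>finite R\<close> \<open>finite G\<close>, of "\<lambda>_ _. 1::nat" "\<lambda>g e. disjnt e g"] by simp
  also have "(\<Sum>g\<in>R. card {e\<in>G. \<not> disjnt e g}) \<le> c * card R"
    using sum_bounded_above[of R, OF meet] by (simp add: mult.commute)
  also have "(\<Sum>e\<in>G. card {g\<in>R. disjnt e g}) \<le> s * card G"
    using sum_bounded_above[of G, OF disj] by (simp add: mult.commute)
  finally show ?thesis by simp
qed

text \<open>Since \<open>f S\<close> avoids \<open>A\<close>, both \<open>S\<close> and
  \<open>x\<close> can be recovered from \<open>S \<union> {x}\<close>, as its parts inside and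
  outside \<open>A\<close>; so no edge is counted twice.\<close>

lemma card_M_hypergraph:
  assumes "finite A" and "\<And>S. S \<in> nsets A 2 \<Longrightarrow> finite (f S) \<and> disjnt A (f S)"
  shows "card (M_hypergraph A f) = (\<Sum>S\<in>nsets A 2. card (f S))"
proof -
  let ?g = "\<lambda>(S, x). S \<union> {x}"
  have trace: "A \<inter> (S \<union> {x}) = S" "S \<union> {x} - A = {x}" if "S \<in> nsets A 2" "x \<in> f S" for S x
    using that assms(2)[OF that(1)] by (auto simp: nsets_def disjnt_iff)
  have "inj_on ?g (Sigma (nsets A 2) f)"
  proof (rule inj_onI, clarify)
    fix S x T y
    assume *: "S \<in> nsets A 2" "x \<in> f S" "T \<in> nsets A 2" "y \<in> f T" "S \<union> {x} = T \<union> {y}"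
    then show "S = T \<and> x = y"
      using trace[of S x] trace[of T y] by auto
  qed
  moreover have "M_hypergraph A f = ?g ` Sigma (nsets A 2) f"
    by (auto simp: M_hypergraph_def)
  moreover have "finite (nsets A 2)"
    using assms(1) by (rule finite_imp_finite_nsets)
  ultimately show ?thesis
    using assms(2) by (simp add: card_image card_SigmaI)
qed

section \<open>Setting, degrees and heavy pairs\<close>

text \<open>Assuming only a lower bound on \<open>card F\<close> serves both claims: deriving
  equality and the structure from it yields the upper bound and the extremal case together.\<close>

locale large_hypergraph =
  fixes s :: nat and F :: "'a set set"
  assumes s_gt: "s > 625"
    and uniform: "uniform_hypergraph 3 F"
    and almost: "almost_intersecting s F"
    and avoided: "pairs_avoided F"
    and large: "card F \<ge> 6 * s + 10"
begin

definition deg :: "'a \<Rightarrow> nat" where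
  "deg x = card {e\<in>F. x \<in> e}"

definition codeg :: "'a \<Rightarrow> 'a \<Rightarrow> nat" where
  "codeg x y = card {e\<in>F. x \<in> e \<and> y \<in> e}"

text \<open>With threshold 57, \<open>card_light_edges\<close> gives at most \<open>22 * 56 = 1232\<close> light edges, fewer than
  \<open>2 s + 1\<close>, and \<open>card_avoid_heavy\<close> has the error factor \<open>57 / 54 = 19 / 18\<close>.\<close>
definition heavy :: "'a \<Rightarrow> 'a \<Rightarrow> bool" where
  "heavy x y \<longleftrightarrow> x \<noteq> y \<and> codeg x y \<ge> 57"

definition light_edges :: "'a set set" where
  "light_edges = {e\<in>F. \<forall>x\<in>e. \<forall>y\<in>e. \<not> heavy x y}"

lemma finite_F [simp]: "finite F"
  using uniform by (simp add: uniform_hypergraph_def)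

lemma card_edge: "e \<in> F \<Longrightarrow> card e = 3"
  and finite_edge: "e \<in> F \<Longrightarrow> finite e"
  using uniform by (auto simp: uniform_hypergraph_def)

lemma edge_eqI:
  assumes "e \<in> F" "x \<in> e" "y \<in> e" "z \<in> e" "x \<noteq> y" "x \<noteq> z" "y \<noteq> z"
  shows "e = {x, y, z}"
  using card_subset_eq[of e "{x, y, z}"] card_edge finite_edge assms by auto

lemma codeg_commute: "codeg x y = codeg y x"
  unfolding codeg_def by (rule arg_cong[of _ _ card]) blast

lemma heavy_commute: "heavy x y \<longleftrightarrow> heavy y x"
  by (auto simp: heavy_def codeg_commute)

section \<open>Edges meeting or missing a fixed edge\<close>

lemma card_disjnt_le:
  assumes "e \<in> F" "R \<subseteq> F"
  shows "card {g\<in>R. disjnt e g} \<le> s"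
proof -
  have "card {g\<in>R. disjnt e g} \<le> card {g\<in>F. disjnt e g}"
    using assms by (intro card_mono) auto
  then show ?thesis
    using almost assms(1) by (fastforce simp: almost_intersecting_def)
qed

lemma card_split_disjnt_le:
  assumes "g \<in> F" "G \<subseteq> F"
  shows "card G \<le> card {e\<in>G. \<not> disjnt e g} + s"
proof -
  have "finite G" using assms(2) finite_F by (rule finite_subset)
  then have "card G \<le> card {e\<in>G. \<not> disjnt e g} + card {e\<in>G. disjnt g e}"
    by (intro order_trans[OF card_mono card_Un_le]) (auto simp: disjnt_sym)
  then show ?thesis
    using card_disjnt_le[OF assms] by linarith
qed

lemma card_meet_le_sum:
  assumes "finite g" "G \<subseteq> F"
  shows "card {e\<in>G. \<not> disjnt e g} \<le> (\<Sum>c\<in>g. card {e\<in>G. c \<in> e})"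
proof -
  have fin: "finite G"
    using assms(2) finite_F by (rule finite_subset)
  have "card {e\<in>G. \<not> disjnt e g} \<le> card (\<Union>c\<in>g. {e\<in>G. c \<in> e})"
    using assms(1) fin by (intro card_mono) (auto simp: disjnt_iff)
  also have "\<dots> \<le> (\<Sum>c\<in>g. card {e\<in>G. c \<in> e})"
    by (rule card_UN_le[OF assms(1)])
  finally show ?thesis .
qed

lemma card_meet_le:
  assumes "g \<in> F" "G \<subseteq> F" "\<And>c. c \<in> g \<Longrightarrow> card {e\<in>G. c \<in> e} \<le> m"
  shows "card {e\<in>G. \<not> disjnt e g} \<le> 3 * m"
proof -
  have "(\<Sum>c\<in>g. card {e\<in>G. c \<in> e}) \<le> of_nat (card g) * m"
    using assms(3) by (rule sum_bounded_above)
  then show ?thesis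
    using card_meet_le_sum[OF finite_edge[OF assms(1)] assms(2)] card_edge[OF assms(1)] by simp
qed

text \<open>Each of the three vertices \<open>c\<close> of \<open>g\<close> lies in at most one edge
  through \<open>x\<close> and \<open>y\<close>, namely \<open>{x, y, c}\<close>.\<close>

lemma card_pair_meet_le:
  assumes "x \<noteq> y" "g \<in> F" "x \<notin> g" "y \<notin> g"
  shows "card {e\<in>{e\<in>F. x \<in> e \<and> y \<in> e}. \<not> disjnt e g} \<le> 3"
proof -
  have "card {e\<in>{e\<in>F. x \<in> e \<and> y \<in> e}. c \<in> e} \<le> 1" if "c \<in> g" for c
  proof -
    have "{e\<in>{e\<in>F. x \<in> e \<and> y \<in> e}. c \<in> e} \<subseteq> {{x, y, c}}"
      using edge_eqI[of _ x y c] assms that by blast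
    from card_mono[OF _ this] show ?thesis by simp
  qed
  then show ?thesis
    using card_meet_le[OF assms(2), of "{e\<in>F. x \<in> e \<and> y \<in> e}" 1] by auto
qed

lemma ex_edge_avoiding:
  assumes "e \<in> F" "x \<in> e" "y \<in> e" "x \<noteq> y"
  obtains g where "g \<in> F" "x \<notin> g" "y \<notin> g"
proof -
  have "\<exists>g\<in>F. disjnt g {x, y}"
    using avoided[unfolded pairs_avoided_def, rule_format, OF assms] .
  then show thesis using that by auto
qed

section \<open>Upper bounds for codegrees and degrees\<close>

text \<open>If any edge contains both vertices, some edge avoids them; it meets at most three edges
  through the pair and is disjoint from at most \<open>s\<close>.\<close>

lemma codeg_le:
  assumes "x \<noteq> y"
  shows "codeg x y \<le> s + 3"
proof (cases "{e\<in>F. x \<in> e \<and> y \<in> e} = {}")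
  case False
  then obtain e where "e \<in> F" "x \<in> e" "y \<in> e" by blast
  then obtain g where g: "g \<in> F" "x \<notin> g" "y \<notin> g"
    using ex_edge_avoiding assms by metis
  have "{e\<in>F. x \<in> e \<and> y \<in> e} \<subseteq> F" by blast
  from card_pair_meet_le[OF assms g] card_split_disjnt_le[OF g(1) this] show ?thesis
    unfolding codeg_def by linarith
next
  case True
  then show ?thesis
    unfolding codeg_def by (metis card.empty zero_le)
qed

lemma card_avoid_vertex: "card {e\<in>F. x \<notin> e} + deg x = card F"
proof -
  have "F = {e\<in>F. x \<notin> e} \<union> {e\<in>F. x \<in> e}" by blast
  moreover have "card ({e\<in>F. x \<notin> e} \<union> {e\<in>F. x \<in> e}) = card {e\<in>F. x \<notin> e} + card {e\<in>F. x \<in> e}"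
    by (rule card_Un_disjoint) auto
  ultimately show ?thesis by (simp add: deg_def)
qed

text \<open>An edge \<open>g\<close> avoiding \<open>x\<close> meets at most
  \<open>3 * (s + 3)\<close> edges through \<open>x\<close>, by the codegree bound at its three
  vertices, and misses at most \<open>s\<close>. Hence \<open>deg x\<close> is at most
  \<open>4 * s + 9\<close>, which is subtracted from \<open>6 * s + 10\<close>.\<close>

lemma card_avoid_vertex_ge: "card {e\<in>F. x \<notin> e} \<ge> 2 * s + 1"
proof (cases "{e\<in>F. x \<in> e} = {}")
  case True
  then have "deg x = 0" unfolding deg_def by (metis card.empty)
  then show ?thesis
    using card_avoid_vertex[of x] large by linarith
next
  case False
  then obtain e where e: "e \<in> F" "x \<in> e" by blast
  have "e \<noteq> {x}" using card_edge[OF e(1)] by auto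
  then obtain y where "y \<in> e" "y \<noteq> x" using e by blast
  then obtain g where g: "g \<in> F" "x \<notin> g"
    using ex_edge_avoiding e by metis
  have "card {e\<in>{e\<in>F. x \<in> e}. c \<in> e} \<le> s + 3" if "c \<in> g" for c
    using codeg_le[of x c] that g unfolding codeg_def by auto
  then have "card {e\<in>{e\<in>F. x \<in> e}. \<not> disjnt e g} \<le> 3 * (s + 3)"
    using g(1) by (intro card_meet_le) auto
  moreover have "deg x \<le> card {e\<in>{e\<in>F. x \<in> e}. \<not> disjnt e g} + s"
    unfolding deg_def using g(1) by (intro card_split_disjnt_le) auto
  ultimately have "deg x \<le> 3 * (s + 3) + s" by linarith
  then show ?thesis
    using card_avoid_vertex[of x] large by arith
qed

section \<open>Few edges contain no heavy pair\<close>

text \<open>An edge avoiding \<open>x\<close> meets at most \<open>3 * 56 = 168\<close> light edges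
  through \<open>x\<close>. With \<open>337 = 2 * 168 + 1\<close> light edges through
  \<open>x\<close>, more than half would miss each such edge, so fewer than \<open>2 * s\<close>
  edges would avoid \<open>x\<close>.\<close>

lemma card_light_edges_vertex: "card {e\<in>light_edges. x \<in> e} \<le> 336"
proof (rule ccontr)
  let ?G = "{e\<in>light_edges. x \<in> e}" and ?R = "{e\<in>F. x \<notin> e}"
  assume "\<not> card ?G \<le> 336"
  then have big: "card ?G \<ge> 337" by simp
  have GF: "?G \<subseteq> F" by (auto simp: light_edges_def)
  have "card {e\<in>?G. \<not> disjnt e g} \<le> 3 * 56" if "g \<in> ?R" for g
  proof (rule card_meet_le)
    fix c assume "c \<in> g"
    then have "c \<noteq> x" using that by auto
    show "card {e\<in>?G. c \<in> e} \<le> 56"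
    proof (cases "{e\<in>?G. c \<in> e} = {}")
      case False
      then have "\<not> heavy x c" by (auto simp: light_edges_def)
      moreover have "card {e\<in>?G. c \<in> e} \<le> codeg x c"
        unfolding codeg_def by (rule card_mono) (auto simp: light_edges_def)
      ultimately show ?thesis using \<open>c \<noteq> x\<close> by (auto simp: heavy_def)
    qed (metis card.empty zero_le)
  qed (use that GF in auto)
  then have "card ?G * card ?R \<le> 3 * 56 * card ?R + s * card ?G"
    using GF by (intro card_mult_le_of_disjnt_le card_disjnt_le) (auto intro: finite_subset)
  \<comment> \<open>The offset \<open>k\<close> replaces the difference \<open>card ?G - 168\<close>
    by \<open>169 + k\<close>, avoiding truncated subtraction.\<close>
  moreover obtain k where k: "card ?G = 337 + k"
    using big le_Suc_ex by blast
  ultimately have "(169 + k) * card ?R \<le> s * (337 + k)"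
    by (simp add: algebra_simps)
  moreover have "(169 + k) * (2 * s + 1) \<le> (169 + k) * card ?R"
    using card_avoid_vertex_ge by (rule mult_le_mono2)
  moreover have "(169 + k) * (2 * s + 1) = s * (337 + k) + s + s * k + 169 + k"
    by (simp add: algebra_simps)
  ultimately show False by linarith
qed

text \<open>Every edge meets at most \<open>3 * 336 = 18 * 56\<close> light edges. More than
  \<open>22 * 56\<close> of them would give \<open>card F\<close> at most \<open>22 / 4 * s\<close>,
  below \<open>6 * s\<close>.\<close>

lemma card_light_edges: "card light_edges \<le> 1232"
proof (rule ccontr)
  assume "\<not> card light_edges \<le> 1232"
  then have "1233 \<le> card light_edges" by simp
  then obtain k where k: "card light_edges = 1233 + k"
    using le_Suc_ex by blast
  have LF: "light_edges \<subseteq> F" by (auto simp: light_edges_def)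
  have "card {e\<in>light_edges. \<not> disjnt e g} \<le> 3 * 336" if "g \<in> F" for g
    using card_meet_le[OF that LF] card_light_edges_vertex by blast
  then have "card light_edges * card F \<le> 3 * 336 * card F + s * card light_edges"
    using LF by (intro card_mult_le_of_disjnt_le card_disjnt_le) (auto intro: finite_subset)
  then have "(225 + k) * card F \<le> s * (1233 + k)"
    by (simp add: k algebra_simps)
  moreover have "(225 + k) * (6 * s + 10) \<le> (225 + k) * card F"
    using large by (rule mult_le_mono2)
  moreover have "(225 + k) * (6 * s + 10) = s * (1233 + k) + 117 * s + 5 * (s * k) + 2250 + 10 * k"
    by (simp add: algebra_simps)
  ultimately show False by linarith
qed

lemma ex_heavy_avoiding:
  obtains a b where "heavy a b" "x \<noteq> a" "x \<noteq> b"
proof -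
  have "\<not> {e\<in>F. x \<notin> e} \<subseteq> light_edges"
  proof
    assume "{e\<in>F. x \<notin> e} \<subseteq> light_edges"
    then have "card {e\<in>F. x \<notin> e} \<le> card light_edges"
      by (intro card_mono) (auto simp: light_edges_def)
    then show False
      using card_avoid_vertex_ge[of x] card_light_edges s_gt by linarith
  qed
  then obtain e a b where "e \<in> F" "x \<notin> e" "a \<in> e" "b \<in> e" "heavy a b"
    by (auto simp: light_edges_def)
  then show thesis using that by metis
qed

section \<open>Degrees and codegrees around heavy pairs\<close>

lemma card_avoid_heavy:
  assumes "heavy a b"
  shows "18 * card {e\<in>F. a \<notin> e \<and> b \<notin> e} \<le> 19 * s"
proof -
  let ?G = "{e\<in>F. a \<in> e \<and> b \<in> e}" and ?R = "{e\<in>F. a \<notin> e \<and> b \<notin> e}"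
  have "card ?G * card ?R \<le> 3 * card ?R + s * card ?G"
    using assms by (intro card_mult_le_of_disjnt_le card_disjnt_le card_pair_meet_le)
      (auto simp: heavy_def)
  moreover obtain k where k: "card ?G = 57 + k"
    using assms le_Suc_ex unfolding heavy_def codeg_def by blast
  ultimately have *: "(54 + k) * card ?R \<le> s * (57 + k)"
    by (simp add: algebra_simps)
  show ?thesis
  proof (rule ccontr)
    assume "\<not> ?thesis"
    \<comment> \<open>The case \<open>k = 0\<close> is the tight one:
      \<open>18 * 57 = 19 * 54\<close>.\<close>
    then have "(54 + k) * (19 * s + 1) \<le> (54 + k) * (18 * card ?R)"
      by (intro mult_le_mono2) simp
    also have "\<dots> \<le> 18 * (s * (57 + k))"
      using * by linarith
    finally show False by (simp add: algebra_simps)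
  qed
qed

text \<open>An edge through \<open>x\<close> contains \<open>a\<close>, contains \<open>b\<close>,
  or misses the heavy pair; the last kind is rare.\<close>

lemma deg_le_heavy:
  assumes "heavy a b" "x \<noteq> a" "x \<noteq> b"
  shows "18 * deg x \<le> 18 * codeg x a + 18 * codeg x b + 19 * s"
proof -
  have "deg x \<le> card ({e\<in>F. x \<in> e \<and> a \<in> e} \<union> {e\<in>F. x \<in> e \<and> b \<in> e} \<union> {e\<in>F. a \<notin> e \<and> b \<notin> e})"
    unfolding deg_def by (rule card_mono) auto
  also have "\<dots> \<le> codeg x a + codeg x b + card {e\<in>F. a \<notin> e \<and> b \<notin> e}"
    unfolding codeg_def by (meson add_le_mono1 card_Un_le le_trans)
  finally show ?thesis
    using card_avoid_heavy[OF assms(1)] by linarith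
qed

text \<open>Few edges miss both \<open>x\<close> and \<open>y\<close>, so their degrees nearly add
  up to \<open>card F + codeg x y\<close>. A heavy pair avoiding \<open>y\<close> bounds
  \<open>deg y\<close> from above, which leaves a large degree for \<open>x\<close>.\<close>

lemma deg_ge_heavy:
  assumes "heavy x y"
  shows "18 * deg x \<ge> 34 * s + 72 + 18 * codeg x y"
proof -
  obtain a b where ab: "heavy a b" "y \<noteq> a" "y \<noteq> b"
    by (rule ex_heavy_avoiding[of y])
  have deg_y: "18 * deg y \<le> 55 * s + 108"
    using deg_le_heavy[OF ab] codeg_le[OF ab(2)] codeg_le[OF ab(3)] by linarith
  have "card ({e\<in>F. x \<in> e} \<union> {e\<in>F. y \<in> e}) + codeg x y = deg x + deg y"
  proof -
    have "{e\<in>F. x \<in> e} \<inter> {e\<in>F. y \<in> e} = {e\<in>F. x \<in> e \<and> y \<in> e}" by blast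
    then show ?thesis
      using card_Un_Int[of "{e\<in>F. x \<in> e}" "{e\<in>F. y \<in> e}"] by (simp add: deg_def codeg_def)
  qed
  moreover have "card F \<le> card ({e\<in>F. x \<in> e} \<union> {e\<in>F. y \<in> e}) + card {e\<in>F. x \<notin> e \<and> y \<notin> e}"
    by (rule order_trans[OF card_mono card_Un_le]) auto
  ultimately show ?thesis
    using card_avoid_heavy[OF assms] deg_y large by linarith
qed

text \<open>A bootstrap. Comparing the lower and upper bounds on \<open>deg x\<close>, first with
  the codegree 57 of \<open>x y\<close>, shows that one of \<open>a\<close>, \<open>b\<close> has
  codegree about \<open>5 * s / 12\<close> with \<open>x\<close>. Using that vertex in place of
  \<open>y\<close> raises the lower bound on \<open>deg x\<close> and gives the stated sum.\<close>

lemma heavy_triangle: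
  assumes "heavy x y" "heavy a b" "x \<noteq> a" "x \<noteq> b"
  shows "4 * codeg x a + 4 * codeg x b \<ge> 5 * s + 138" "heavy x a" "heavy x b"
proof -
  obtain p where p: "heavy x p" "36 * codeg x p \<ge> 15 * s + 1098"
  proof -
    have "18 * codeg x a + 18 * codeg x b \<ge> 15 * s + 1098"
      using deg_le_heavy[OF assms(2-4)] deg_ge_heavy[OF assms(1)] assms(1)
      unfolding heavy_def by linarith
    then have "36 * codeg x a \<ge> 15 * s + 1098 \<or> 36 * codeg x b \<ge> 15 * s + 1098"
      by linarith
    then show thesis
    proof
      assume "36 * codeg x a \<ge> 15 * s + 1098"
      then show thesis using that[of a] assms(3) s_gt by (simp add: heavy_def)
    next
      assume "36 * codeg x b \<ge> 15 * s + 1098"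
      then show thesis using that[of b] assms(4) s_gt by (simp add: heavy_def)
    qed
  qed
  show *: "4 * codeg x a + 4 * codeg x b \<ge> 5 * s + 138"
    using deg_le_heavy[OF assms(2-4)] deg_ge_heavy[OF p(1)] p(2) by linarith
  \<comment> \<open>Neither codegree exceeds \<open>s + 3\<close>, so each must supply at least
    about \<open>s / 4\<close> of the sum.\<close>
  show "heavy x a" "heavy x b"
    using * codeg_le[OF assms(3)] codeg_le[OF assms(4)] s_gt assms(3,4)
    by (auto simp: heavy_def)
qed

section \<open>The vertices lying in heavy pairs\<close>

definition heavy_vertices :: "'a set" where
  "heavy_vertices = {x. \<exists>y. heavy x y}"

lemma heavy_complete:
  assumes "x \<in> heavy_vertices" "y \<in> heavy_vertices" "x \<noteq> y"
  shows "heavy x y"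
proof -
  obtain p q where p: "heavy x p" and q: "heavy y q"
    using assms(1,2) by (auto simp: heavy_vertices_def)
  show ?thesis
    using heavy_triangle(2)[OF p q assms(3)] q by (cases "q = x") (auto simp: heavy_commute)
qed

lemma codeg_heavy_sum:
  assumes "a \<in> heavy_vertices" "b \<in> heavy_vertices" "c \<in> heavy_vertices"
    and "a \<noteq> b" "a \<noteq> c" "b \<noteq> c"
  shows "4 * codeg a b + 4 * codeg a c \<ge> 5 * s + 138"
  using heavy_triangle(1)[of a b b c] heavy_complete assms by blast

lemma finite_heavy_vertices: "finite heavy_vertices"
proof (rule finite_subset)
  show "heavy_vertices \<subseteq> \<Union>F"
  proof
    fix x assume "x \<in> heavy_vertices"
    then obtain y where "heavy x y" by (auto simp: heavy_vertices_def)
    then have "codeg x y \<noteq> 0" by (simp add: heavy_def)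
    then have "{e\<in>F. x \<in> e \<and> y \<in> e} \<noteq> {}" unfolding codeg_def by (metis card.empty)
    then show "x \<in> \<Union>F" by blast
  qed
  show "finite (\<Union>F)" using finite_edge by (intro finite_Union) auto
qed

text \<open>Three heavy vertices span at most three heavy pairs, covering at most
  \<open>3 * s + 9\<close> edges; together with at most 1232 light edges this falls short of
  \<open>6 * s + 10\<close>.\<close>

lemma card_heavy_vertices: "card heavy_vertices \<ge> 4"
proof (rule ccontr)
  let ?P = "nsets heavy_vertices 2"
  assume "\<not> ?thesis"
  then have "card heavy_vertices choose 2 \<le> 3 choose 2"
    by (intro binomial_right_mono) simp
  then have card_P: "card ?P \<le> 3"
    by (simp add: choose_two)
  have fin_P: "finite ?P"
    using finite_heavy_vertices by (rule finite_imp_finite_nsets)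
  have "F \<subseteq> light_edges \<union> (\<Union>p\<in>?P. {e\<in>F. p \<subseteq> e})"
  proof
    fix e assume e: "e \<in> F"
    show "e \<in> light_edges \<union> (\<Union>p\<in>?P. {e\<in>F. p \<subseteq> e})"
    proof (cases "e \<in> light_edges")
      case False
      then obtain x y where xy: "x \<in> e" "y \<in> e" "heavy x y"
        using e by (auto simp: light_edges_def)
      then have "{x, y} \<in> ?P"
        by (auto simp: heavy_vertices_def heavy_commute heavy_def codeg_commute)
      then show ?thesis using xy e by blast
    qed simp
  qed
  then have "card F \<le> card light_edges + card (\<Union>p\<in>?P. {e\<in>F. p \<subseteq> e})"
    using fin_P by (intro order_trans[OF card_mono card_Un_le]) (auto simp: light_edges_def)
  moreover have "card (\<Union>p\<in>?P. {e\<in>F. p \<subseteq> e}) \<le> 3 * s + 9"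
  proof -
    have "card {e\<in>F. p \<subseteq> e} \<le> s + 3" if p: "p \<in> ?P" for p
    proof -
      obtain x y where "x \<noteq> y" "p = {x, y}" using nsets2_E[OF p] by metis
      then show ?thesis using codeg_le[of x y] by (simp add: codeg_def)
    qed
    then have "(\<Sum>p\<in>?P. card {e\<in>F. p \<subseteq> e}) \<le> of_nat (card ?P) * (s + 3)"
      by (rule sum_bounded_above)
    also have "\<dots> \<le> 3 * (s + 3)"
      using card_P by (intro mult_le_mono1) simp
    finally show ?thesis
      using card_UN_le[OF fin_P, of "\<lambda>p. {e\<in>F. p \<subseteq> e}"] by simp
  qed
  ultimately show False
    using card_light_edges large s_gt by linarith
qed

text \<open>If \<open>f\<close> misses \<open>a\<close>, \<open>b\<close>, \<open>c\<close> in
  \<open>A\<close>, the edges through \<open>a b\<close> or \<open>a c\<close> number more than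
  \<open>5 * s / 4\<close>, up to one common edge. At most six of them meet \<open>f\<close>, so
  more than \<open>s\<close> are disjoint from it.\<close>

lemma card_edge_Int_heavy:
  assumes A: "A \<subseteq> heavy_vertices" "card A = 4" and f: "f \<in> F"
  shows "card (A \<inter> f) \<ge> 2"
proof (rule ccontr)
  assume "\<not> ?thesis"
  moreover have finA: "finite A"
    using A(2) by (metis card.infinite zero_neq_numeral)
  ultimately have "3 \<le> card (A - f)"
    using A(2) card_Diff_subset_Int[of A f] by simp
  then obtain T where T: "T \<subseteq> A - f" "card T = 3"
    by (metis obtain_subset_with_card_n)
  then obtain a b c where abc: "a \<in> A - f" "b \<in> A - f" "c \<in> A - f" "a \<noteq> b" "a \<noteq> c" "b \<noteq> c"
    by (auto simp: card_3_iff)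
  let ?B = "{e\<in>F. a \<in> e \<and> b \<in> e}" and ?C = "{e\<in>F. a \<in> e \<and> c \<in> e}"
  have "?B \<inter> ?C \<subseteq> {{a, b, c}}"
    using edge_eqI[of _ a b c] abc by blast
  then have "card (?B \<inter> ?C) \<le> 1"
    using card_mono[of "{{a, b, c}}" "?B \<inter> ?C"] by simp
  moreover have "codeg a b + codeg a c = card (?B \<union> ?C) + card (?B \<inter> ?C)"
    unfolding codeg_def by (rule card_Un_Int) auto
  moreover have "card (?B \<union> ?C) \<le> card {e\<in>?B \<union> ?C. \<not> disjnt e f} + s"
    using f by (intro card_split_disjnt_le) auto
  moreover have "card {e\<in>?B \<union> ?C. \<not> disjnt e f} \<le> 3 + 3"
  proof -
    have "card {e\<in>?B \<union> ?C. \<not> disjnt e f} \<le> card {e\<in>?B. \<not> disjnt e f} + card {e\<in>?C. \<not> disjnt e f}"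
      by (rule order_trans[OF card_mono card_Un_le]) auto
    also have "\<dots> \<le> 3 + 3"
      using abc f by (intro add_mono card_pair_meet_le) auto
    finally show ?thesis .
  qed
  moreover have "4 * codeg a b + 4 * codeg a c \<ge> 5 * s + 138"
    using codeg_heavy_sum[of a b c] abc A(1) by blast
  ultimately show False by linarith
qed

section \<open>The exact structure of a large hypergraph\<close>

lemma extremal_structure:
  "card F = 6 * s + 10 \<and> (\<exists>A B f. M_datum s A B f \<and> F = M_hypergraph A f \<union> nsets A 3)"
proof -
  obtain A where A: "A \<subseteq> heavy_vertices" "card A = 4" "finite A"
    using card_heavy_vertices obtain_subset_with_card_n by metis
  define f where "f S = {x. x \<notin> A \<and> S \<union> {x} \<in> F}" for S
  let ?P = "nsets A 2" and ?T = "F \<inter> nsets A 3"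
  have compl: "A - S \<in> ?P" if "S \<in> ?P" for S
    using that A by (auto simp: nsets_def card_Diff_subset)
  have fin_f: "finite (f S)" for S
  proof (rule finite_subset)
    show "f S \<subseteq> \<Union>F" by (auto simp: f_def)
    show "finite (\<Union>F)" using finite_edge by (intro finite_Union) auto
  qed
  \<comment> \<open>A pair in \<open>A\<close> is heavy, while at most four edges through it have
    their third vertex in \<open>A\<close>. Nonemptiness on the complementary pair later supplies
    the edge that bounds \<open>f S\<close>.\<close>
  have f_nonempty: "f S \<noteq> {}" if S: "S \<in> ?P" for S
  proof
    assume empty: "f S = {}"
    obtain x y where xy: "S = {x, y}" "x \<in> A" "y \<in> A" "x \<noteq> y"
      using nsets2_E[OF S] by metis
    have "{e\<in>F. x \<in> e \<and> y \<in> e} \<subseteq> (\<lambda>c. {x, y, c}) ` A"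
    proof
      fix e assume e: "e \<in> {e\<in>F. x \<in> e \<and> y \<in> e}"
      have "card (e - {x, y}) = 1"
        using e card_edge[of e] finite_edge[of e] xy(4) by (simp add: card_Diff_subset)
      then obtain c where c: "e - {x, y} = {c}" by (auto simp: card_1_singleton_iff)
      have "e = {x, y, c}" using c e by blast
      moreover have "c \<in> A"
      proof (rule ccontr)
        assume "c \<notin> A"
        moreover have "S \<union> {c} = e" using c e xy(1) by blast
        ultimately have "c \<in> f S" using e by (simp add: f_def)
        then show False using empty by simp
      qed
      ultimately show "e \<in> (\<lambda>c. {x, y, c}) ` A" by (rule image_eqI)
    qed
    then have "codeg x y \<le> card ((\<lambda>c. {x, y, c}) ` A)"
      unfolding codeg_def using A(3) by (intro card_mono) auto
    also have "\<dots> \<le> 4"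
      using card_image_le[OF A(3)] A(2) by metis
    finally have "codeg x y \<le> 4" .
    moreover have "heavy x y"
      using heavy_complete xy A(1) by blast
    ultimately show False by (simp add: heavy_def)
  qed
  have card_f_Diff: "card (f S - {x}) \<le> s" if S: "S \<in> ?P" and x: "x \<in> f (A - S)" for S x
  proof -
    have "inj_on (\<lambda>y. S \<union> {y}) (f S - {x})"
      using S by (auto simp: inj_on_def f_def nsets_def)
    then have "card (f S - {x}) = card ((\<lambda>y. S \<union> {y}) ` (f S - {x}))"
      by (simp add: card_image)
    also have "\<dots> \<le> card {g\<in>F. disjnt (A - S \<union> {x}) g}"
      using S x by (intro card_mono) (auto simp: f_def disjnt_iff nsets_def)
    also have "\<dots> \<le> s"
      using x by (intro card_disjnt_le) (auto simp: f_def)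
    finally show ?thesis .
  qed
  \<comment> \<open>The extra 1 accounts for \<open>x\<close> itself: \<open>S \<union> {x}\<close>
    meets the edge \<open>(A - S) \<union> {x}\<close>.\<close>
  have card_f: "card (f S) \<le> s + 1" if S: "S \<in> ?P" for S
  proof -
    obtain x where "x \<in> f (A - S)" using f_nonempty[OF compl[OF S]] by blast
    then show ?thesis
      using card_f_Diff[OF S, of x] fin_f[of S] by (cases "x \<in> f S") auto
  qed
  have F_eq: "F = M_hypergraph A f \<union> ?T"
  proof
    show "F \<subseteq> M_hypergraph A f \<union> ?T"
    proof
      fix e assume e: "e \<in> F"
      show "e \<in> M_hypergraph A f \<union> ?T"
      proof (cases "e \<subseteq> A")
        case True
        then show ?thesis using e card_edge finite_edge by (auto simp: nsets_def)
      next
        case False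
        then obtain x where x: "x \<in> e" "x \<notin> A" by blast
        \<comment> \<open>\<open>A \<inter> e\<close> has at least two elements and sits inside the
          two-element set \<open>e - {x}\<close>, so they coincide.\<close>
        have "A \<inter> e \<subseteq> e - {x}" using x by blast
        moreover have "card (e - {x}) = 2" using e x card_edge by simp
        moreover have "card (A \<inter> e) \<ge> 2" using card_edge_Int_heavy A(1,2) e by blast
        ultimately have "A \<inter> e = e - {x}"
          using finite_edge[OF e] by (intro card_seteq) auto
        then have "e = (A \<inter> e) \<union> {x}" "card (A \<inter> e) = 2"
          using x \<open>card (e - {x}) = 2\<close> by auto
        then have "A \<inter> e \<in> ?P" "x \<in> f (A \<inter> e)"
          using A(3) x e by (auto simp: nsets_def f_def)
        then show ?thesis
          using \<open>e = (A \<inter> e) \<union> {x}\<close> unfolding M_hypergraph_def by blast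
      qed
    qed
  qed (auto simp: M_hypergraph_def f_def)
  have card_P: "card ?P = 6" and card_T3: "card (nsets A 3) = 4"
    using A(2) by (simp_all add: choose_two binomial_symmetric[of 3 4])
  have fin_T3: "finite (nsets A 3)" and fin_P: "finite ?P"
    using A(3) by (auto intro: finite_imp_finite_nsets)
  have card_M: "card (M_hypergraph A f) = (\<Sum>S\<in>?P. card (f S))"
    using A(3) fin_f by (intro card_M_hypergraph) (auto simp: f_def disjnt_iff)
  have sum_le: "(\<Sum>S\<in>?P. card (f S)) \<le> 6 * s + 6"
    using sum_bounded_above[of ?P "\<lambda>S. card (f S)" "s + 1"] card_f card_P by simp
  have card_F_le: "card F \<le> (\<Sum>S\<in>?P. card (f S)) + card ?T"
    using F_eq card_Un_le[of "M_hypergraph A f" ?T] card_M by simp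
  have card_T: "card ?T \<le> 4"
    using card_mono[OF fin_T3, of ?T] card_T3 by simp
  \<comment> \<open>Six pairs with at most \<open>s + 1\<close> edges each and four triples give
    exactly the assumed lower bound, so equality holds in every estimate.\<close>
  have "card F = 6 * s + 10"
    using card_F_le card_T sum_le large by linarith
  have "?T = nsets A 3"
    using card_F_le card_T sum_le large card_T3 by (intro card_seteq[OF fin_T3]) auto
  have card_f_eq: "card (f S) = s + 1" if S: "S \<in> ?P" for S
  proof (rule ccontr)
    assume "card (f S) \<noteq> s + 1"
    then have "card (f S) < s + 1" using card_f[OF S] by simp
    then have "(\<Sum>S\<in>?P. card (f S)) < (\<Sum>S\<in>?P. s + 1)"
      using S card_f by (intro sum_strict_mono_ex1[OF fin_P]) auto
    then show False
      using card_F_le card_T large card_P by simp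
  qed
  \<comment> \<open>An \<open>x\<close> outside \<open>f S\<close> would leave all
    \<open>s + 1\<close> elements in \<open>f S - {x}\<close>, exceeding the bound
    \<open>s\<close>.\<close>
  have f_sub: "f (A - S) \<subseteq> f S" if "S \<in> ?P" for S
  proof
    fix x assume "x \<in> f (A - S)"
    then show "x \<in> f S"
      using card_f_Diff[OF that, of x] card_f_eq[OF that] by (cases "x \<in> f S") auto
  qed
  have f_compl: "f S = f (A - S)" if S: "S \<in> ?P" for S
  proof -
    have "A - (A - S) = S" using S by (auto simp: nsets_def)
    then show ?thesis using f_sub[OF S] f_sub[OF compl[OF S]] by auto
  qed
  define B where "B = (\<Union>S\<in>?P. f S)"
  have fin_B: "finite B" using fin_P fin_f by (simp add: B_def)
  have "?P \<noteq> {}" using card_P by (metis card.empty zero_neq_numeral)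
  then obtain S where "S \<in> ?P" by blast
  then have "card B \<ge> s + 1"
    using card_f_eq[of S] card_mono[OF fin_B, of "f S"] by (auto simp: B_def)
  moreover have "f \<in> ?P \<rightarrow> nsets B (s + 1)"
    using fin_f card_f_eq by (auto simp: nsets_def B_def)
  moreover have "disjnt A B" by (auto simp: disjnt_iff B_def f_def)
  ultimately have "M_datum s A B f"
    using A fin_B f_compl by (auto simp: M_datum_def)
  then show ?thesis
    using F_eq \<open>?T = nsets A 3\<close> \<open>card F = 6 * s + 10\<close> by metis
qed

end

section \<open>The converse: \<open>M_hypergraph\<close> together with all four triples of
  \<open>A\<close>\<close>

text \<open>Every edge has at least two vertices in the four-element set \<open>A\<close>. Hence
  triples inside \<open>A\<close> meet all edges, and an edge \<open>S \<union> {x}\<close> misses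
  only edges \<open>(A - S) \<union> {y}\<close> with \<open>y\<close> in \<open>f S - {x}\<close>,
  which leaves \<open>s\<close> choices.\<close>

lemma M_datum_extremal:
  fixes A :: "'a set"
  assumes "s > 0" and M: "M_datum s A B f"
  defines "F \<equiv> M_hypergraph A f \<union> nsets A 3"
  shows "uniform_hypergraph 3 F" "almost_intersecting s F" "pairs_avoided F" "card F = 6 * s + 10"
proof -
  have A: "finite A" "card A = 4" and AB: "disjnt A B"
    and f_Pi: "f \<in> nsets A 2 \<rightarrow> nsets B (s + 1)"
    and f_compl: "\<And>S. S \<in> nsets A 2 \<Longrightarrow> f S = f (A - S)"
    using M unfolding M_datum_def by blast+
  have f: "f S \<subseteq> B \<and> finite (f S) \<and> card (f S) = s + 1" if "S \<in> nsets A 2" for S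
    using funcset_mem[OF f_Pi that] by (simp add: nsets_def)
  have fA: "x \<notin> A" if "S \<in> nsets A 2" "x \<in> f S" for S x
    using that f AB by (auto simp: disjnt_iff)
  have compl: "A - S \<in> nsets A 2" if "S \<in> nsets A 2" for S
    using that A by (auto simp: nsets_def card_Diff_subset)
  have card_P: "card (nsets A 2) = 6" and card_T: "card (nsets A 3) = 4"
    using A(2) by (simp_all add: choose_two binomial_symmetric[of 3 4])
  have card_M: "card (M_hypergraph A f) = 6 * s + 6"
  proof -
    have "card (M_hypergraph A f) = (\<Sum>S\<in>nsets A 2. card (f S))"
      using A(1) f fA by (intro card_M_hypergraph) (auto simp: disjnt_iff)
    also have "\<dots> = (\<Sum>S\<in>nsets A 2. s + 1)"
      using f by (intro sum.cong) auto
    finally show ?thesis using card_P by simp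
  qed
  then have fin_M: "finite (M_hypergraph A f)"
    by (intro card_ge_0_finite) simp
  have fin_T: "finite (nsets A 3)"
    using A(1) by (rule finite_imp_finite_nsets)
  have M_inter: "M_hypergraph A f \<inter> nsets A 3 = {}"
    using fA by (auto simp: M_hypergraph_def nsets_def)
  show "card F = 6 * s + 10"
    using card_Un_disjoint[OF fin_M fin_T M_inter] card_M card_T by (simp add: F_def)
  show "uniform_hypergraph 3 F"
    unfolding uniform_hypergraph_def F_def
  proof (intro conjI ballI)
    show "finite (M_hypergraph A f \<union> nsets A 3)" using fin_M fin_T by simp
    fix e assume e: "e \<in> M_hypergraph A f \<union> nsets A 3"
    show "finite e" using e by (auto simp: M_hypergraph_def nsets_def)
    from e show "card e = 3"
    proof
      assume "e \<in> M_hypergraph A f"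
      then obtain S x where "S \<in> nsets A 2" "x \<in> f S" "e = S \<union> {x}"
        by (auto simp: M_hypergraph_def)
      moreover from this have "x \<notin> S" using fA by (auto simp: nsets_def)
      ultimately show ?thesis by (auto simp: nsets_def)
    qed (simp add: nsets_def)
  qed
  have two_le: "2 \<le> card (e \<inter> A)" if "e \<in> F" for e
  proof -
    from that consider "e \<in> nsets A 3" | S x where "S \<in> nsets A 2" "e = S \<union> {x}"
      by (auto simp: F_def M_hypergraph_def)
    then show ?thesis
    proof cases
      case 1
      then have "e \<inter> A = e" by (auto simp: nsets_def)
      then show ?thesis using 1 by (simp add: nsets_def)
    next
      case 2
      then have "card S \<le> card (e \<inter> A)" using A(1) by (intro card_mono) (auto simp: nsets_def)
      then show ?thesis using 2 by (simp add: nsets_def)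
    qed
  qed
  have disj_le: "card (e \<inter> A) + card (g \<inter> A) \<le> 4" if "disjnt e g" for e g
  proof -
    have "card (e \<inter> A) + card (g \<inter> A) = card ((e \<inter> A) \<union> (g \<inter> A))"
      using A(1) that by (intro card_Un_disjoint[symmetric]) (auto simp: disjnt_iff)
    also have "\<dots> \<le> card A" using A(1) by (intro card_mono) auto
    finally show ?thesis using A(2) by simp
  qed
  show "almost_intersecting s F"
    unfolding almost_intersecting_def
  proof
    fix e assume "e \<in> F"
    then consider "e \<in> nsets A 3" | S x where "S \<in> nsets A 2" "x \<in> f S" "e = S \<union> {x}"
      by (auto simp: F_def M_hypergraph_def)
    then show "card {g\<in>F. disjnt e g} \<le> s"
    proof cases
      case 1
      then have "card (e \<inter> A) = 3" by (auto simp: nsets_def Int_absorb2)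
      then have "{g\<in>F. disjnt e g} = {}"
        using two_le disj_le by fastforce
      then show ?thesis by (metis card.empty zero_le)
    next
      case 2
      have "{g\<in>F. disjnt e g} \<subseteq> (\<lambda>y. (A - S) \<union> {y}) ` (f S - {x})"
      proof clarify
        fix g assume g: "g \<in> F" "disjnt e g"
        have "g \<notin> nsets A 3"
        proof
          assume "g \<in> nsets A 3"
          then have "card (g \<inter> A) = 3" by (auto simp: nsets_def Int_absorb2)
          then show False using two_le[OF \<open>e \<in> F\<close>] disj_le[OF g(2)] by simp
        qed
        then obtain T y where T: "T \<in> nsets A 2" "y \<in> f T" "g = T \<union> {y}"
          using g(1) by (auto simp: F_def M_hypergraph_def)
        have "T \<subseteq> A - S" using T g(2) 2 by (auto simp: nsets_def disjnt_iff)
        then have "T = A - S"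
          using T(1) compl[OF 2(1)] A(1) by (intro card_subset_eq) (auto simp: nsets_def)
        moreover have "y \<in> f S - {x}"
          using T g(2) 2 \<open>T = A - S\<close> f_compl[OF 2(1)] by (auto simp: disjnt_iff)
        ultimately show "g \<in> (\<lambda>y. (A - S) \<union> {y}) ` (f S - {x})" using T(3) by blast
      qed
      then have "card {g\<in>F. disjnt e g} \<le> card (f S - {x})"
        using f[OF 2(1)] by (meson card_image_le card_mono finite_Diff finite_imageI le_trans)
      then show ?thesis using f[OF 2(1)] 2(2) by simp
    qed
  qed
  show "pairs_avoided F"
    unfolding pairs_avoided_def
  proof (intro ballI impI)
    fix e x y assume e: "e \<in> F" and xy: "x \<in> e" "y \<in> e" "x \<noteq> y"
    have "2 \<le> card (A - {x, y})"
      using A diff_card_le_card_Diff[of "{x, y}" A] xy(3) by simp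
    then obtain S where S: "S \<subseteq> A - {x, y}" "card S = 2"
      by (metis obtain_subset_with_card_n)
    then have SP: "S \<in> nsets A 2"
      using A(1) by (auto simp: nsets_def intro: finite_subset)
    \<comment> \<open>An edge has at most one vertex outside \<open>A\<close>, so \<open>f S\<close>
      contains at most one of \<open>x\<close>, \<open>y\<close>; having at least two elements, it
      offers a third vertex \<open>z\<close> different from both.\<close>
    have "x \<in> A \<or> y \<in> A"
    proof (rule ccontr)
      assume *: "\<not> ?thesis"
      then have "e \<notin> nsets A 3" using xy by (auto simp: nsets_def)
      then obtain T z where "T \<in> nsets A 2" "e = T \<union> {z}"
        using e by (auto simp: F_def M_hypergraph_def)
      then show False using xy * by (auto simp: nsets_def)
    qed
    then have "f S \<subseteq> {x} \<or> f S \<subseteq> {y}" if "f S \<subseteq> {x, y}"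
      using fA[OF SP] that by blast
    moreover have "card (f S) \<ge> 2" using f[OF SP] \<open>s > 0\<close> by simp
    ultimately have "\<not> f S \<subseteq> {x, y}"
      using card_mono[of "{x}" "f S"] card_mono[of "{y}" "f S"] by auto
    then obtain z where "z \<in> f S" "z \<noteq> x" "z \<noteq> y" by blast
    then have "S \<union> {z} \<in> F" "disjnt (S \<union> {z}) {x, y}"
      using SP S by (auto simp: F_def M_hypergraph_def disjnt_iff)
    then show "\<exists>e'\<in>F. disjnt e' {x, y}" by blast
  qed
qed

theorem theorem4p4:
  fixes s :: nat
  assumes "s > 625"
  shows "(\<forall>F :: 'a set set.
            uniform_hypergraph 3 F \<and> almost_intersecting s F \<and> pairs_avoided F \<longrightarrow>
              card F \<le> 6 * s + 10 \<and>
              (card F = 6 * s + 10 \<longrightarrow>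
                (\<exists>A B f E. M_datum s A B f \<and> E \<subseteq> nsets A 3 \<and> F = M_hypergraph A f \<union> E))) \<and>
         (\<forall>(A :: 'a set) B f. M_datum s A B f \<longrightarrow>
            (let F = M_hypergraph A f \<union> nsets A 3 in
              uniform_hypergraph 3 F \<and> almost_intersecting s F \<and> pairs_avoided F \<and>
              card F = 6 * s + 10))"
proof (intro conjI allI impI)
  fix F :: "'a set set"
  assume F: "uniform_hypergraph 3 F \<and> almost_intersecting s F \<and> pairs_avoided F"
  \<comment> \<open>The equality rules out more edges, and in the extremal case the witness
    \<open>E\<close> is the whole of \<open>nsets A 3\<close>.\<close>
  have large: "card F = 6 * s + 10 \<and> (\<exists>A B f. M_datum s A B f \<and> F = M_hypergraph A f \<union> nsets A 3)"
    if "card F \<ge> 6 * s + 10"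
    using F assms that by (intro large_hypergraph.extremal_structure) (auto simp: large_hypergraph_def)
  show "card F \<le> 6 * s + 10"
    using large by linarith
  assume "card F = 6 * s + 10"
  then show "\<exists>A B f E. M_datum s A B f \<and> E \<subseteq> nsets A 3 \<and> F = M_hypergraph A f \<union> E"
    using large by (metis order_refl)
next
  fix A :: "'a set" and B f
  assume "M_datum s A B f"
  then show "let F = M_hypergraph A f \<union> nsets A 3 in
      uniform_hypergraph 3 F \<and> almost_intersecting s F \<and> pairs_avoided F \<and> card F = 6 * s + 10"
    using M_datum_extremal[of s A B f] assms by (simp add: Let_def)
qed

end
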